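(* For every $(k,\alpha)\in\bigcup_{\ell\in\mathbb Z_{\ge0}}\bigl(\{\ell\}\times\ell\Delta(f)\bigr)$ and every $q\in\{1,\dots,n+1\}$, $$L_q(\pi(k,\alpha))+\tilde L_q(k,\alpha)=0.$$
   Context: Let $n\ge1$. Let $\alpha(1),\dots,\alpha(n+2)\in\mathbb Z^n$ with $\alpha(n+1)=0$, such that the convex hull of $\alpha(1),\dots,\alpha(n+1)$ is an $n$-dimensional simplex and $\alpha(n+2)$ lies in its interior. Put $f(x)=\sum_{j=1}^n x^{\alpha(j)}+1+s\,x^{\alpha(n+2)}$, with Newton polytope $\Delta(f)$, and $f_0(x)=x^{-\alpha(n+2)}f(x)-s$. The latter's Newton polytope $\Delta(f_0)$ is the simplex with vertices $\alpha_0(j)=\alpha(j)-\alpha(n+2)$, $1\le j\le n+1$. $\mathsf L$ is the $(n+2)\times(n+2)$ matrix with rows $(\alpha(j),0,1)$ for $1\le j\le n$, then $(0,\dots,0,0,1)$, then $(\alpha(n+2),1,1)$; $\gamma=\det\mathsf L$, the $\alpha(j)$ being ordered so that $\gamma>0$. $\mathcal L_q(\alpha,z,k)=(\alpha,z,k)\cdot w_q$ with $w_q$ the $q$-th column of $\mathsf L^{-1}$. $B_q=n!\,\mathrm{vol}$ of the convex hull of $\{\alpha(i)\}_{i=1}^{n+2}\setminus\{\alpha(q)\}$. Define: - $\tilde L_q(k,\alpha)=\frac{\gamma}{B_q}\mathcal L_q(\alpha,0,k)$ for $1\le q\le n+1$. - $\pi(k,\alpha)=(k,\alpha-k\,\alpha(n+2))$.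 - For $1\le q\le n+1$, $\Delta_q(f_0)$ is the convex hull of $\{\alpha_0(j):1\le j\le n+1,\ j\ne q\}$, and $\mathsf C\Delta_q(f_0)=\bigcup_{\tilde\alpha\in\Delta_q(f_0)}\mathbb R_{\ge0}(1,\tilde\alpha)\subset\mathbb R^{n+1}$. - $L_q$ is the linear function on $\mathbb R^{n+1}$ with $L_q(k,\tilde\alpha)=0$ for all $(k,\tilde\alpha)\in\mathsf C\Delta_q(f_0)$ and $L_q(k,0)=-k$ for $k\in\{1,\dots,n\}$. *)

theory Defs
  imports "HOL-Analysis.Analysis" "HOL-Library.Poly_Mapping"
begin

text \<open>
  With n the number of elements of the type \<open>'n\<close>, the index set 1, ..., n+2 is
  \<open>'n option option\<close>: the index j \<open>\<le>\<close> n is \<open>Some (Some j)\<close>, and n+1 and n+2 are the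
  following two constants.  The same type indexes the coordinates (\<open>\<alpha>\<close>, z, k) of
  n+2 dimensional space, in this order, so that determinants of square matrices are defined
  and have the sign that they have for the indices 1, ..., n+2.
\<close>

abbreviation idx :: "'n \<Rightarrow> 'n option option" where
  "idx j \<equiv> Some (Some j)"

abbreviation idx_n1 :: "'n option option" where
  "idx_n1 \<equiv> Some None"

abbreviation idx_n2 :: "'n option option" where
  "idx_n2 \<equiv> None"

definition rvec :: "int ^ 'n \<Rightarrow> real ^ 'n" where
  "rvec v = (\<chi> i. of_int (v $ i))"

text \<open>
  A Laurent polynomial is a finitely supported family of coefficients indexed by the exponents.
\<close>

definition newton_polytope :: "((int ^ 'n) \<Rightarrow>\<^sub>0 'a::zero) \<Rightarrow> (real ^ 'n) set" where
  "newton_polytope p = convex hull (rvec ` Poly_Mapping.keys p)"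

definition laurent_f ::
  "('n::finite option option \<Rightarrow> int ^ 'n) \<Rightarrow> 'a::comm_ring_1 \<Rightarrow> ((int ^ 'n) \<Rightarrow>\<^sub>0 'a)" where
  "laurent_f \<alpha> s = (\<Sum>j\<in>UNIV. Poly_Mapping.single (\<alpha> (idx j)) 1) + 1
     + Poly_Mapping.single (\<alpha> idx_n2) s"

definition join :: "real ^ 'n \<Rightarrow> real \<Rightarrow> real \<Rightarrow> real ^ ('n option option)" where
  "join a z k = (\<chi> c. case c of Some (Some i) \<Rightarrow> a $ i | Some None \<Rightarrow> z | None \<Rightarrow> k)"

definition L_mat ::
  "('n::finite option option \<Rightarrow> int ^ 'n) \<Rightarrow> real ^ ('n option option) ^ ('n option option)" where
  "L_mat \<alpha> = (\<chi> r. case r of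
      Some (Some j) \<Rightarrow> join (rvec (\<alpha> (idx j))) 0 1
    | Some None \<Rightarrow> join 0 0 1
    | None \<Rightarrow> join (rvec (\<alpha> idx_n2)) 1 1)"

definition gamma :: "('n::finite option option \<Rightarrow> int ^ 'n) \<Rightarrow> real" where
  "gamma \<alpha> = det (L_mat \<alpha>)"

definition calL ::
  "('n::finite option option \<Rightarrow> int ^ 'n) \<Rightarrow> 'n option option
     \<Rightarrow> real ^ 'n \<Rightarrow> real \<Rightarrow> real \<Rightarrow> real" where
  "calL \<alpha> q a z k = join a z k \<bullet> column q (matrix_inv (L_mat \<alpha>))"

definition B_vol ::
  "('n::finite option option \<Rightarrow> int ^ 'n) \<Rightarrow> 'n option option \<Rightarrow> real" where
  "B_vol \<alpha> q = fact CARD('n) *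
     measure lebesgue (convex hull (range (\<lambda>i. rvec (\<alpha> i)) - {rvec (\<alpha> q)}))"

definition L_tilde ::
  "('n::finite option option \<Rightarrow> int ^ 'n) \<Rightarrow> 'n option option \<Rightarrow> real \<times> (real ^ 'n) \<Rightarrow> real" where
  "L_tilde \<alpha> q = (\<lambda>(k, a). gamma \<alpha> / B_vol \<alpha> q * calL \<alpha> q a 0 k)"

definition proj ::
  "('n::finite option option \<Rightarrow> int ^ 'n) \<Rightarrow> real \<times> (real ^ 'n) \<Rightarrow> real \<times> (real ^ 'n)" where
  "proj \<alpha> = (\<lambda>(k, a). (k, a - k *\<^sub>R rvec (\<alpha> idx_n2)))"

definition \<alpha>0 ::
  "('n::finite option option \<Rightarrow> int ^ 'n) \<Rightarrow> 'n option option \<Rightarrow> int ^ 'n" where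
  "\<alpha>0 \<alpha> j = \<alpha> j - \<alpha> idx_n2"

definition facet ::
  "('n::finite option option \<Rightarrow> int ^ 'n) \<Rightarrow> 'n option option \<Rightarrow> (real ^ 'n) set" where
  "facet \<alpha> q = convex hull {rvec (\<alpha>0 \<alpha> j) | j. j \<noteq> idx_n2 \<and> j \<noteq> q}"

definition cone_facet ::
  "('n::finite option option \<Rightarrow> int ^ 'n) \<Rightarrow> 'n option option \<Rightarrow> (real \<times> (real ^ 'n)) set" where
  "cone_facet \<alpha> q = (\<Union>v\<in>facet \<alpha> q. {c *\<^sub>R (1, v) | c. 0 \<le> c})"

definition L_facet ::
  "('n::finite option option \<Rightarrow> int ^ 'n) \<Rightarrow> 'n option option \<Rightarrow> real \<times> (real ^ 'n) \<Rightarrow> real" where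
  "L_facet \<alpha> q = (THE L. linear L \<and> (\<forall>x\<in>cone_facet \<alpha> q. L x = 0) \<and>
     (\<forall>k\<in>{1..CARD('n)}. L (real k, 0) = - real k))"

end

theory Submission
  imports Defs
begin

text \<open>
  The proof compares linear forms by means of coordinates. Since \<open>\<gamma> \<noteq> 0\<close> and \<open>\<alpha>(n+1) = 0\<close>, the
  vectors \<open>(\<alpha>(r), 1)\<close> with \<open>r \<le> n+1\<close> form a basis of \<open>\<real>\<^sup>n \<times> \<real>\<close>. The corresponding coordinates of
  \<open>(a, k)\<close> are the values \<open>u\<^sub>r(a, k) = calL \<alpha> r a 0 k\<close>, because \<open>(a, 0, k)\<close> is the combination of the
  rows of the matrix \<open>L_mat \<alpha>\<close> with coefficients \<open>calL \<alpha> r a 0 k\<close>, and the last row, the only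
  one with a nonzero z-entry, gets coefficient 0 (lemma \<open>calL_expansion\<close>). Write \<open>\<lambda>\<^sub>r = u\<^sub>r(\<alpha>(n+2), 1)\<close>
  for the barycentric coordinates of the last point; all of them are positive because that point
  is interior to the simplex (lemma \<open>calL_interior_point_pos\<close>).
  
  Both summands of the asserted identity are multiples of \<open>u\<^sub>q\<close>.
  
  \<^item> The number \<open>B\<^sub>q\<close> is the normalised volume of the simplex obtained by replacing the vertex \<open>\<alpha>(q)\<close> by
    \<open>\<alpha>(n+2)\<close>. The normalised volume of a simplex with vertices \<open>p\<^sub>r\<close> is the absolute value of the
    determinant with rows \<open>(p\<^sub>r, 1)\<close>, and for the simplex of the \<open>\<alpha>(r)\<close> this determinant is \<open>\<plusminus>\<gamma>\<close>.
    Cramer's rule for the replaced row gives \<open>B\<^sub>q = \<lambda>\<^sub>q \<gamma>\<close> (lemma \<open>B_vol_eq\<close>), so the second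
    form is \<open>u\<^sub>q(a, k) / \<lambda>\<^sub>q\<close>.
  
  \<^item> A linear form that vanishes on \<open>(1, \<alpha>(r) - \<alpha>(n+2))\<close> for all \<open>r \<noteq> q\<close> is, as a function of
    \<open>(k, b)\<close>, a multiple of \<open>u\<^sub>q(b + k \<alpha>(n+2), k)\<close>. The latter takes the value \<open>\<lambda>\<^sub>q\<close> at \<open>(1, 0)\<close>, so the
    normalisation \<open>L(1, 0) = -1\<close> determines the factor \<open>- 1 / \<lambda>\<^sub>q\<close> (lemma \<open>L_facet_eq\<close>). The projection
    substitutes \<open>b = a - k \<alpha>(n+2)\<close>, which leaves \<open>- u\<^sub>q(a, k) / \<lambda>\<^sub>q\<close>.
\<close>

section \<open>Determinants with trivial rows\<close>

text \<open>
  If the rows outside the range of \<open>f\<close> are rows of the identity matrix, only the permutations that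
  fix all indices outside the range contribute to the Leibniz sum, and these are
  the permutations of \<open>'m\<close> transported along \<open>f\<close>. Taking \<open>f = Some\<close> gives Laplace
  expansion along a unit row; taking \<open>f\<close> bijective gives invariance under renaming
  the indices, between different types.
\<close>

lemma det_principal_minor:
  fixes f :: "'m::finite \<Rightarrow> 'n::finite" and A :: "'a::comm_ring_1 ^ 'n ^ 'n"
  assumes f: "inj f" and triv: "\<And>i c. i \<notin> range f \<Longrightarrow> A $ i $ c = (if c = i then 1 else 0)"
  shows "det A = det (\<chi> i j. A $ f i $ f j)"
proof -
  define t where "t p = of_int (sign p) * (\<Prod>i\<in>UNIV. A $ i $ p i)" for p
  let ?u = "\<lambda>p. of_int (sign p) * (\<Prod>i\<in>UNIV. A $ f i $ f (p i))"
  have bij: "bij_betw f UNIV (range f)" and bij': "bij_betw (inv f) (range f) UNIV"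
    using f inj_imp_bij_betw_inv by (auto simp: bij_betw_def)
  have "t p = 0" if p: "p permutes UNIV" and np: "\<not> p permutes range f" for p
  proof -
    obtain i where "i \<notin> range f" "p i \<noteq> i"
      using permutes_superset[OF p, of "range f"] np by blast
    then have "A $ i $ p i = 0"
      using triv by simp
    then show ?thesis
      unfolding t_def by (metis UNIV_I finite prod_zero mult_zero_right)
  qed
  moreover have "{p. p permutes range f} \<subseteq> {p. p permutes UNIV}"
    using permutes_subset by blast
  ultimately have "det A = (\<Sum>p\<in>{p. p permutes range f}. t p)"
    unfolding det_def t_def by (intro sum.mono_neutral_right finite_permutations) auto
  also have "\<dots> = (\<Sum>p\<in>{p. p permutes (UNIV :: 'm set)}. ?u p)"
  proof (rule sum.reindex_bij_witness[where i = "map_permutation UNIV f"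
        and j = "map_permutation (range f) (inv f)"])
    fix p assume p: "p \<in> {p. p permutes range f}"
    show inv: "map_permutation UNIV f (map_permutation (range f) (inv f) p) = p"
      using p f by (intro map_permutation_compose_inv[OF bij']) (auto simp: f_inv_into_f)
    show q: "map_permutation (range f) (inv f) p \<in> {p. p permutes UNIV}"
      using p map_permutation_permutes[OF bij'] by blast
    let ?q = "map_permutation (range f) (inv f) p"
    have ap: "p (f i) = f (?q i)" for i
      using map_permutation_apply[OF f, of i ?q] inv by simp
    have sg: "sign ?q = sign p"
      using p bij' by (intro sign_map_permutation) (auto simp: bij_betw_def)
    have "(\<Prod>i\<in>UNIV. A $ i $ p i) = (\<Prod>i\<in>range f. A $ i $ p i)"
      using p triv by (intro prod.mono_neutral_right) (auto simp: permutes_not_in)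
    also have "\<dots> = (\<Prod>i\<in>UNIV. A $ f i $ f (?q i))"
      by (simp add: prod.reindex[OF f] ap)
    finally show "?u ?q = t p"
      by (simp add: t_def sg)
  next
    fix p :: "'m \<Rightarrow> 'm" assume p: "p \<in> {p. p permutes UNIV}"
    show "map_permutation (range f) (inv f) (map_permutation UNIV f p) = p"
      using p f by (intro map_permutation_compose_inv[OF bij]) auto
    show "map_permutation UNIV f p \<in> {p. p permutes range f}"
      using p map_permutation_permutes[OF bij] by blast
  qed
  also have "\<dots> = det (\<chi> i j. A $ f i $ f j)"
    by (simp add: det_def)
  finally show ?thesis .
qed

section \<open>Volume of a simplex\<close>

lemma prod_Basis_vec:
  fixes g :: "real ^ 'n::finite \<Rightarrow> 'b::comm_monoid_mult"
  shows "prod g Basis = (\<Prod>i\<in>UNIV. g (axis i 1))"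
proof -
  have "bij_betw (\<lambda>i :: 'n. axis i (1::real)) UNIV Basis"
    by (auto simp: bij_betw_def inj_def axis_eq_axis Basis_vec_def)
  from prod.reindex_bij_betw[OF this, of g] show ?thesis
    by simp
qed

text \<open>
  Lebesgue measure is determined by its values on boxes, and renaming the coordinates maps
  boxes to boxes with the same side lengths. The two index types may differ.
\<close>

lemma measure_permute_coordinates:
  fixes b :: "'m::finite \<Rightarrow> 'n::finite" and S :: "(real ^ 'n) set"
  assumes b: "bij b" and S: "compact S"
  shows "measure lebesgue ((\<lambda>x. \<chi> i. x $ b i) ` S) = measure lebesgue S"
proof -
  define e where "e = (\<lambda>x :: real ^ 'n. (\<chi> i. x $ b i) :: real ^ 'm)"
  have lin: "linear e"
    by (auto simp: e_def linear_iff vec_eq_iff)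
  have cont: "continuous_on X e" for X
    by (simp add: lin linear_continuous_on linear_linear)
  have inj: "inj e"
    unfolding e_def inj_def vec_eq_iff by (metis vec_lambda_beta b bij_pointE)
  have [measurable]: "e \<in> borel_measurable borel"
    using cont by (rule borel_measurable_continuous_onI)
  have prodB: "(\<Prod>c\<in>Basis. (u - l) \<bullet> c) = (\<Prod>i\<in>UNIV. u $ i - l $ i)"
    for u l :: "real ^ 'k::finite"
    by (subst prod_Basis_vec) (simp add: inner_axis)
  have distr: "lborel = distr lborel borel e"
  proof (rule lborel_eqI)
    fix l u :: "real ^ 'm"
    assume le: "\<And>c. c \<in> Basis \<Longrightarrow> l \<bullet> c \<le> u \<bullet> c"
    define l' where "l' = (\<chi> i. l $ inv b i)"
    define u' where "u' = (\<chi> i. u $ inv b i)"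
    have le': "l $ i \<le> u $ i" for i
      using le[of "axis i 1"] by (simp add: inner_axis)
    have pre: "e -` box l u = box l' u'"
      unfolding box_def Basis_vec_def
      by (auto simp: e_def l'_def u'_def inner_axis)
        (metis b bij_inv_eq_iff)+
    have "emeasure (distr lborel borel e) (box l u) = emeasure lborel (box l' u')"
      by (simp add: emeasure_distr pre)
    also have "\<dots> = (\<Prod>c\<in>Basis. (u' - l') \<bullet> c)"
      using le' by (intro emeasure_lborel_box) (auto simp: Basis_vec_def inner_axis l'_def u'_def)
    also have "(\<Prod>c\<in>Basis. (u' - l') \<bullet> c) = (\<Prod>i\<in>UNIV. u $ i - l $ i)"
      unfolding prodB u'_def l'_def
      using prod.reindex_bij_betw[OF bij_imp_bij_inv[OF b], of "\<lambda>i. u $ i - l $ i"] by simp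
    also have "\<dots> = (\<Prod>c\<in>Basis. (u - l) \<bullet> c)"
      by (rule prodB[symmetric])
    finally show "emeasure (distr lborel borel e) (box l u) = (\<Prod>c\<in>Basis. (u - l) \<bullet> c)" .
  qed simp
  have cS: "compact (e ` S)"
    using S cont compact_continuous_image by blast
  have "measure lborel (e ` S) = measure (distr lborel borel e) (e ` S)"
    by (subst distr) (rule refl)
  also have "\<dots> = measure lborel (e -` e ` S)"
    using cS by (simp add: measure_distr borel_compact)
  finally have "measure lborel (e ` S) = measure lborel (e -` e ` S)" .
  then have "measure lborel (e ` S) = measure lborel S"
    by (simp add: inj inj_vimage_image_eq)
  then show ?thesis
    unfolding e_def[symmetric] using S cS by (simp add: measure_completion borel_compact)
qed

text \<open>
  The theorem \<open>content_simplex\<close> on the volume of a simplex in \<open>real ^ 'n\<close> requires the index type to be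
  well-ordered. A copy of a finite index type, ordered by an arbitrary injection into the natural
  numbers, has this property, and renaming the coordinates transfers the volume back.
\<close>

typedef 'n wellordered_index = "UNIV :: 'n set"
  by simp

lemma bij_Rep_wellordered_index: "bij Rep_wellordered_index"
  by (rule bijI) (simp_all add: inj_def Rep_wellordered_index_inject
      type_definition.Rep_range[OF type_definition_wellordered_index])

instance wellordered_index :: (finite) finite
proof
  show "finite (UNIV :: 'a wellordered_index set)"
    using bij_betw_finite[OF bij_Rep_wellordered_index[where ?'a = 'a]] by simp
qed

instantiation wellordered_index :: (finite) wellorder
begin

definition index_rank :: "'a wellordered_index \<Rightarrow> nat" where
  "index_rank = (SOME f. inj f)"

lemma inj_index_rank: "inj (index_rank :: 'a wellordered_index \<Rightarrow> nat)"
proof -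
  have "\<exists>f :: 'a wellordered_index \<Rightarrow> nat. inj f"
    using finite_imp_inj_to_nat_seg[of "UNIV :: 'a wellordered_index set"] by auto
  then show ?thesis
    unfolding index_rank_def by (rule someI_ex)
qed

definition "x \<le> y \<longleftrightarrow> index_rank x \<le> index_rank y"
definition "x < y \<longleftrightarrow> index_rank x < index_rank y"

instance
proof
  fix P :: "'a wellordered_index \<Rightarrow> bool" and a
  assume step: "\<And>x. (\<And>y. y < x \<Longrightarrow> P y) \<Longrightarrow> P x"
  show "P a"
  proof (induction a rule: measure_induct_rule[of index_rank])
    case (less x)
    then show ?case
      using step by (simp add: less_wellordered_index_def)
  qed
next
  fix x y :: "'a wellordered_index"
  show "x \<le> y \<Longrightarrow> y \<le> x \<Longrightarrow> x = y"
    unfolding less_eq_wellordered_index_def by (rule injD[OF inj_index_rank]) (rule antisym)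
qed (unfold less_wellordered_index_def less_eq_wellordered_index_def, linarith+)

end

text \<open>
  The rows are the points in homogeneous coordinates, with the coordinate 1 at the index \<open>None\<close>.
  Unlike the matrix of edge vectors at a chosen vertex, this matrix treats all vertices alike,
  so that replacing any one of them is a change of a single row.
\<close>

definition homogeneous_mat :: "('n option \<Rightarrow> real ^ 'n) \<Rightarrow> real ^ 'n option ^ 'n option" where
  "homogeneous_mat p = (\<chi> r c. case c of None \<Rightarrow> 1 | Some i \<Rightarrow> p r $ i)"

text \<open>
  Subtracting row \<open>None\<close> from all the others turns the column of ones into a unit column, and expansion
  along it leaves the matrix of edge vectors at \<open>p None\<close>. The bijection \<open>f\<close> at the same time renames
  the indices of the smaller matrix.
\<close>

lemma det_homogeneous_mat:
  fixes f :: "'m::finite \<Rightarrow> 'n::finite" and p :: "'n option \<Rightarrow> real ^ 'n"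
  assumes f: "bij f"
  shows "det (homogeneous_mat p) = det (\<chi> i j. p (Some (f j)) $ f i - p None $ f i)"
proof -
  define D :: "real ^ 'n option ^ 'n option" where
    "D = (\<chi> r c. case c of None \<Rightarrow> if r = None then 1 else 0
       | Some i \<Rightarrow> if r = None then p None $ i else p r $ i - p None $ i)"
  define E :: "real ^ 'n option ^ 'n option" where
    "E = (\<chi> r c. if c = r \<or> c = None then 1 else 0)"
  \<comment> \<open>Multiplication by \<open>E\<close> adds row \<open>None\<close> of \<open>D\<close> to all its other rows.\<close>
  have "homogeneous_mat p = E ** D"
    unfolding homogeneous_mat_def E_def D_def matrix_matrix_mult_def vec_eq_iff
    by (auto simp: UNIV_option_conv sum.reindex if_distrib[of "\<lambda>x. x * _"] sum.delta
        cong: if_cong split: option.splits)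
  moreover have "det E = 1"
  proof -
    have "det E = det (\<chi> i j. E $ Some i $ Some j)"
      by (rule det_principal_minor) (auto simp: E_def notin_range_Some)
    also have "(\<chi> i j. E $ Some i $ Some j) = mat 1"
      by (auto simp: E_def mat_def vec_eq_iff)
    finally show ?thesis by simp
  qed
  moreover have "det D = det (transpose D)"
    by simp
  moreover have "det (transpose D) = det (\<chi> i j. transpose D $ Some (f i) $ Some (f j))"
  proof (rule det_principal_minor[of "\<lambda>i. Some (f i)"])
    show "inj (\<lambda>i. Some (f i))"
      using f by (auto simp: inj_def bij_def)
    show "transpose D $ i $ c = (if c = i then 1 else 0)" if "i \<notin> range (\<lambda>i. Some (f i))" for i c
    proof -
      have "i = None"
        using that f by (cases i) (auto simp: bij_def surj_def image_iff)
      then show ?thesis by (simp add: D_def transpose_def)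
    qed
  qed
  ultimately show ?thesis
    by (simp add: det_mul D_def transpose_def)
qed

theorem simplex_volume_homogeneous:
  fixes p :: "'n::finite option \<Rightarrow> real ^ 'n"
  assumes p: "inj p"
  shows "fact CARD('n) * measure lebesgue (convex hull range p) = \<bar>det (homogeneous_mat p)\<bar>"
proof -
  let ?R = "Rep_wellordered_index :: 'n wellordered_index \<Rightarrow> 'n"
  define e where "e = (\<lambda>x :: real ^ 'n. (\<chi> i. x $ ?R i) :: real ^ 'n wellordered_index)"
  have lin: "linear e"
    by (auto simp: e_def linear_iff vec_eq_iff)
  have "inj e"
    unfolding e_def inj_def vec_eq_iff by (metis vec_lambda_beta bij_Rep_wellordered_index bij_pointE)
  then have inj: "inj (\<lambda>r. e (p r))"
    using p by (auto simp: inj_def)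
  have card: "CARD('n wellordered_index) = CARD('n)"
    using bij_Rep_wellordered_index bij_betw_same_card by blast
  let ?X = "range (\<lambda>r. e (p r))"
  have "measure lebesgue (convex hull range p) = measure lebesgue (e ` (convex hull range p))"
    unfolding e_def
    by (intro measure_permute_coordinates[symmetric] bij_Rep_wellordered_index
        finite_imp_compact_convex_hull) simp
  also have "e ` (convex hull range p) = convex hull ?X"
    by (simp add: convex_hull_linear_image[OF lin] image_image)
  also have "measure lebesgue (convex hull ?X) = measure lborel (convex hull ?X)"
    by (intro measure_completion) (simp add: borel_compact finite_imp_compact_convex_hull)
  also have "\<dots> = \<bar>det (\<chi> i j. e (p (Some (?R j))) $ i - e (p None) $ i)\<bar> / fact CARD('n wellordered_index)"
  proof (rule content_simplex)
    show "card ?X = Suc CARD('n wellordered_index)"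
      using inj by (simp add: card_image card)
    have "?X - {e (p None)} = (\<lambda>r. e (p r)) ` (UNIV - {None})"
      using inj by (simp add: inj_def image_set_diff[OF inj])
    also have "UNIV - {None} = range (\<lambda>j. Some (?R j))"
    proof -
      have "range (\<lambda>j. Some (?R j)) = Some ` range ?R"
        by auto
      also have "range ?R = UNIV"
        using bij_Rep_wellordered_index by (rule bij_is_surj)
      finally show ?thesis
        by (simp add: UNIV_option_conv)
    qed
    finally show "bij_betw (\<lambda>j. e (p (Some (?R j)))) UNIV (?X - {e (p None)})"
      using inj_compose[OF inj, of "\<lambda>j. Some (?R j)"] bij_is_inj[OF bij_Rep_wellordered_index]
      by (simp add: bij_betw_def image_image comp_def inj_def)
  qed auto
  also have "(\<chi> i j. e (p (Some (?R j))) $ i - e (p None) $ i)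
      = (\<chi> i j. p (Some (?R j)) $ ?R i - p None $ ?R i)"
    by (simp add: e_def)
  finally show ?thesis
    by (simp add: det_homogeneous_mat[OF bij_Rep_wellordered_index] card)
qed

section \<open>Barycentric coordinates\<close>

lemma sum_UNIV_option:
  fixes g :: "'b::finite option \<Rightarrow> 'c::comm_monoid_add"
  shows "sum g UNIV = g None + (\<Sum>j\<in>UNIV. g (Some j))"
  by (simp add: UNIV_option_conv sum.reindex)

text \<open>
  The z-column of \<open>L_mat \<alpha>\<close> is a unit column with its 1 in row \<open>None\<close>; deleting both leaves
  the homogeneous matrix of the simplex. The 1 is off the diagonal, and the transposition that
  moves it there costs a sign, which is why the absolute values are compared.
\<close>

lemma abs_gamma:
  fixes \<alpha> :: "'n::finite option option \<Rightarrow> int ^ 'n"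
  assumes "\<alpha> idx_n1 = 0"
  shows "\<bar>gamma \<alpha>\<bar> = \<bar>det (homogeneous_mat (\<lambda>r. rvec (\<alpha> (Some r))))\<bar>"
proof -
  let ?t = "Transposition.transpose None (Some None) :: 'n option option \<Rightarrow> 'n option option"
  define M where "M = (\<chi> i j. L_mat \<alpha> $ i $ ?t j)"
  have "det M = of_int (sign ?t) * det (L_mat \<alpha>)"
    unfolding M_def by (rule det_permute_columns) (simp add: permutes_swap_id)
  then have "\<bar>gamma \<alpha>\<bar> = \<bar>det (Finite_Cartesian_Product.transpose M)\<bar>"
    by (simp add: gamma_def sign_swap_id)
  also have "det (Finite_Cartesian_Product.transpose M)
      = det (\<chi> i j. Finite_Cartesian_Product.transpose M $ Some i $ Some j)"
    by (rule det_principal_minor)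
      (auto simp: notin_range_Some M_def Finite_Cartesian_Product.transpose_def L_mat_def
        join_def split: option.splits)
  also have "(\<chi> i j. Finite_Cartesian_Product.transpose M $ Some i $ Some j)
      = Finite_Cartesian_Product.transpose (homogeneous_mat (\<lambda>r. rvec (\<alpha> (Some r))))"
    using assms
    by (auto simp: vec_eq_iff M_def Finite_Cartesian_Product.transpose_def L_mat_def join_def
        homogeneous_mat_def rvec_def Transposition.transpose_def split: option.splits)
  finally show ?thesis
    by simp
qed

lemma calL_alt:
  "calL \<alpha> q a z k = (join a z k v* matrix_inv (L_mat \<alpha>)) $ q"
  by (simp add: calL_def inner_vec_def column_def vector_matrix_mult_def mult.commute)

lemma calL_affine:
  obtains w c where "\<And>a k. calL \<alpha> q a 0 k = w \<bullet> a + c * k"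
proof
  fix a k
  let ?N = "matrix_inv (L_mat \<alpha>)"
  show "calL \<alpha> q a 0 k = (\<chi> i. ?N $ Some (Some i) $ q) \<bullet> a + ?N $ None $ q * k"
    by (simp add: calL_def inner_vec_def column_def join_def sum_UNIV_option mult.commute)
qed

lemma linear_calL:
  "linear (\<lambda>x. calL \<alpha> q (snd x + fst x *\<^sub>R v) 0 (fst x))"
proof -
  obtain w c where "\<And>a k. calL \<alpha> q a 0 k = w \<bullet> a + c * k"
    using calL_affine by blast
  then show ?thesis
    by (simp add: linear_iff algebra_simps)
qed

context
  fixes \<alpha> :: "'n::finite option option \<Rightarrow> int ^ 'n"
  assumes origin: "\<alpha> idx_n1 = 0" and gamma_pos: "gamma \<alpha> > 0"
begin

lemma L_mat_inverse:
  "L_mat \<alpha> ** matrix_inv (L_mat \<alpha>) = mat 1" "matrix_inv (L_mat \<alpha>) ** L_mat \<alpha> = mat 1"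
proof -
  have "invertible (L_mat \<alpha>)"
    using gamma_pos by (simp add: invertible_det_nz gamma_def)
  then have "L_mat \<alpha> ** matrix_inv (L_mat \<alpha>) = mat 1 \<and> matrix_inv (L_mat \<alpha>) ** L_mat \<alpha> = mat 1"
    unfolding invertible_def matrix_inv_def by (rule someI_ex)
  then show "L_mat \<alpha> ** matrix_inv (L_mat \<alpha>) = mat 1" "matrix_inv (L_mat \<alpha>) ** L_mat \<alpha> = mat 1"
    by auto
qed

lemma calL_vertex:
  "calL \<alpha> q (rvec (\<alpha> (Some r))) 0 1 = (if q = Some r then 1 else 0)"
proof -
  have "L_mat \<alpha> $ Some r = join (rvec (\<alpha> (Some r))) 0 1"
    using origin by (auto simp: L_mat_def rvec_def join_def vec_eq_iff split: option.splits)
  then have "calL \<alpha> q (rvec (\<alpha> (Some r))) 0 1 = (L_mat \<alpha> ** matrix_inv (L_mat \<alpha>)) $ Some r $ q"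
    by (simp add: calL_def inner_vec_def matrix_matrix_mult_def column_def)
  then show ?thesis
    by (simp add: L_mat_inverse mat_def)
qed

text \<open>
  Multiplying \<open>(a, 0, k)\<close> by the inverse of \<open>L_mat \<alpha>\<close> and then by \<open>L_mat \<alpha>\<close> changes nothing, so the values
  of \<open>calL\<close> are the coefficients of \<open>(a, 0, k)\<close> in terms of the rows. The z-coordinate shows that the
  coefficient of row \<open>None\<close> is 0, which leaves an expansion in terms of the vertices alone.
\<close>

lemma calL_expansion:
  shows "a = (\<Sum>r\<in>UNIV. calL \<alpha> (Some r) a 0 k *\<^sub>R rvec (\<alpha> (Some r)))"
    and "k = (\<Sum>r\<in>UNIV. calL \<alpha> (Some r) a 0 k)"
proof -
  let ?u = "\<lambda>q. calL \<alpha> q a 0 k"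
  have "join a 0 k = (join a 0 k v* matrix_inv (L_mat \<alpha>)) v* L_mat \<alpha>"
    by (simp add: vector_matrix_mul_assoc L_mat_inverse)
  then have exp: "join a 0 k $ c = (\<Sum>q\<in>UNIV. ?u q * L_mat \<alpha> $ q $ c)" for c
    unfolding calL_alt by (metis (no_types, lifting) vector_matrix_mult_def vec_lambda_beta mult.commute sum.cong)
  have z: "?u None = 0"
    using exp[of "Some None"]
    by (simp add: sum_UNIV_option L_mat_def join_def)
  show "k = (\<Sum>r\<in>UNIV. ?u (Some r))"
    using exp[of None] z
    by (simp add: sum_UNIV_option L_mat_def join_def)
  show "a = (\<Sum>r\<in>UNIV. ?u (Some r) *\<^sub>R rvec (\<alpha> (Some r)))"
    unfolding vec_eq_iff
  proof
    fix i
    show "a $ i = (\<Sum>r\<in>UNIV. ?u (Some r) *\<^sub>R rvec (\<alpha> (Some r))) $ i"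
      using exp[of "Some (Some i)"] z origin
      by (simp add: sum_UNIV_option L_mat_def join_def rvec_def)
  qed
qed

text \<open>
  The points with nonnegative coordinate form a half-space that contains all vertices and
  therefore their convex hull. An interior point of the hull is interior to the
  half-space, and there the inequality is strict.
\<close>

lemma calL_interior_point_pos:
  assumes int: "rvec (\<alpha> idx_n2) \<in> interior (convex hull ((\<lambda>j. rvec (\<alpha> j)) ` {j. j \<noteq> idx_n2}))"
  shows "calL \<alpha> (Some r) (rvec (\<alpha> idx_n2)) 0 1 > 0"
proof -
  obtain w c where wc: "\<And>a k. calL \<alpha> (Some r) a 0 k = w \<bullet> a + c * k"
    using calL_affine by blast
  let ?H = "{x. w \<bullet> x \<ge> - c}"
  have vert: "w \<bullet> rvec (\<alpha> (Some j)) = (if r = j then 1 else 0) - c" for j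
    using calL_vertex[of "Some r" j] wc[of "rvec (\<alpha> (Some j))" 1] by simp
  have "w \<noteq> 0"
  proof
    assume "w = 0"
    obtain j where "j \<noteq> r"
      by (metis option.distinct(1))
    then show False
      using vert[of r] vert[of j] \<open>w = 0\<close> by simp
  qed
  have "(\<lambda>j. rvec (\<alpha> j)) ` {j. j \<noteq> idx_n2} \<subseteq> ?H"
    using vert by auto
  then have "convex hull ((\<lambda>j. rvec (\<alpha> j)) ` {j. j \<noteq> idx_n2}) \<subseteq> ?H"
    by (intro hull_minimal) (auto simp: convex_halfspace_ge)
  then have "rvec (\<alpha> idx_n2) \<in> interior ?H"
    using int interior_mono by blast
  then show ?thesis
    using \<open>w \<noteq> 0\<close> by (simp add: wc)
qed

text \<open>
  The added point differs from each vertex because its coordinates are all positive, whereas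
  a vertex has a coordinate 0; the vertices have different coordinates. Distinctness is needed since \<open>B_vol\<close> removes the point \<open>\<alpha>(q)\<close> from the set
  of points, which would also remove any other index with the same point.
\<close>

lemma inj_vertices:
  assumes pos: "\<And>r. calL \<alpha> (Some r) (rvec (\<alpha> idx_n2)) 0 1 > 0"
  shows "inj (\<lambda>j. rvec (\<alpha> j))"
proof (rule injI)
  have S: "Some r = j" if "rvec (\<alpha> (Some r)) = rvec (\<alpha> j)" for r j
  proof (cases j)
    case None
    obtain j' where "j' \<noteq> r"
      by (metis option.distinct(1))
    then show ?thesis
      using calL_vertex[of "Some j'" r] that None pos[of j'] by simp
  next
    case (Some r')
    then show ?thesis
      using calL_vertex[of "Some r" r] calL_vertex[of "Some r" r'] that by (simp split: if_splits)
  qed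
  fix i j assume "rvec (\<alpha> i) = rvec (\<alpha> j)"
  then show "i = j"
    using S by (cases i; cases j) metis+
qed

text \<open>
  In the homogeneous matrix, row \<open>r\<close> is replaced by a combination of all rows in which row \<open>r\<close> has the
  barycentric coordinate of the new point as its coefficient. By Cramer's rule, the determinant is
  multiplied by this coefficient.
\<close>

lemma B_vol_eq:
  assumes pos: "\<And>r. calL \<alpha> (Some r) (rvec (\<alpha> idx_n2)) 0 1 > 0"
  shows "B_vol \<alpha> (Some r) = calL \<alpha> (Some r) (rvec (\<alpha> idx_n2)) 0 1 * gamma \<alpha>"
proof -
  let ?P = "\<lambda>r. rvec (\<alpha> (Some r))" and ?u = "\<lambda>i. calL \<alpha> (Some i) (rvec (\<alpha> idx_n2)) 0 1"
  let ?Q = "?P(r := rvec (\<alpha> None))"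
  note inj = inj_vertices[OF pos]
  have "range (\<lambda>i. rvec (\<alpha> i)) - {rvec (\<alpha> (Some r))} = (\<lambda>i. rvec (\<alpha> i)) ` (UNIV - {Some r})"
    using image_set_diff[OF inj, of UNIV "{Some r}"] by simp
  also have "UNIV - {Some r} = range (\<lambda>i. if i = r then None else Some i)"
    by (auto simp: UNIV_option_conv image_iff)
  also have "(\<lambda>i. rvec (\<alpha> i)) ` \<dots> = range ?Q"
    unfolding image_image by (rule arg_cong[of _ _ range]) auto
  finally have range: "range (\<lambda>i. rvec (\<alpha> i)) - {rvec (\<alpha> (Some r))} = range ?Q" .
  have injQ: "inj ?Q"
    using inj by (auto simp: inj_def split: if_splits)
  have "homogeneous_mat ?Q = (\<chi> i. if i = r
      then \<Sum>i\<in>UNIV. (\<chi> i. ?u i) $ i *s row i (homogeneous_mat ?P) else row i (homogeneous_mat ?P))"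
    (is "_ = ?C")
  proof -
    have "homogeneous_mat ?Q $ i $ c = ?C $ i $ c" for i c
    proof (cases c)
      case None
      then show ?thesis
        using calL_expansion(2)[of 1 "rvec (\<alpha> idx_n2)"]
        by (auto simp: homogeneous_mat_def row_def)
    next
      case (Some m)
      have "rvec (\<alpha> idx_n2) $ m = (\<Sum>r\<in>UNIV. ?u r *\<^sub>R ?P r) $ m"
        using calL_expansion(1)[of "rvec (\<alpha> idx_n2)" 1] by simp
      then show ?thesis
        using Some by (simp add: homogeneous_mat_def row_def)
    qed
    then show ?thesis
      by (simp add: vec_eq_iff)
  qed
  then have "det (homogeneous_mat ?Q) = ?u r * det (homogeneous_mat ?P)"
    using cramer_lemma_transpose[of r "\<chi> i. ?u i" "homogeneous_mat ?P"] by simp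
  then have "\<bar>det (homogeneous_mat ?Q)\<bar> = ?u r * gamma \<alpha>"
    using abs_gamma[of \<alpha>] origin gamma_pos pos[of r] by (simp add: abs_mult)
  then show ?thesis
    using simplex_volume_homogeneous[OF injQ] by (simp add: B_vol_def range)
qed

text \<open>
  The coordinates of \<open>(b + k \<alpha>(n+2), k)\<close> are the coefficients of \<open>(k, b)\<close> in terms of the generators
  \<open>(1, \<alpha>0(j))\<close> of the cone over the simplex. All generators except the one with index \<open>r\<close> lie in the cone
  over the facet, hence a linear form vanishing there is determined by its value at the remaining
  generator. As \<open>(1, 0)\<close> has a nonzero coefficient there, the normalisation fixes that value.
\<close>

lemma L_facet_eq:
  assumes pos: "\<And>r. calL \<alpha> (Some r) (rvec (\<alpha> idx_n2)) 0 1 > 0"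
  shows "L_facet \<alpha> (Some r) (k, b) =
    - calL \<alpha> (Some r) (b + k *\<^sub>R rvec (\<alpha> idx_n2)) 0 k / calL \<alpha> (Some r) (rvec (\<alpha> idx_n2)) 0 1"
proof -
  let ?e = "rvec (\<alpha> idx_n2)"
  define l where "l = calL \<alpha> (Some r) ?e 0 1"
  define C where "C j x = calL \<alpha> (Some j) (snd x + fst x *\<^sub>R ?e) 0 (fst x)" for j and x :: "real \<times> (real ^ 'n)"
  define \<Lambda> where "\<Lambda> x = - C r x / l" for x
  have l: "l > 0"
    using pos by (simp add: l_def)
  have linC: "linear (C j)" for j
    unfolding C_def by (rule linear_calL)
  have edge: "rvec (\<alpha>0 \<alpha> j) = rvec (\<alpha> j) - ?e" for j
    by (simp add: \<alpha>0_def rvec_def vec_eq_iff)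
  have C_vertex: "C i (1, rvec (\<alpha>0 \<alpha> (Some j))) = (if i = j then 1 else 0)" for i j
    using calL_vertex[of "Some i" j] by (simp add: C_def edge)
  have span: "x = (\<Sum>j\<in>UNIV. C j x *\<^sub>R (1, rvec (\<alpha>0 \<alpha> (Some j))))" for x
  proof (rule prod_eqI)
    have fst: "fst x = (\<Sum>j\<in>UNIV. C j x)"
      using calL_expansion(2)[of "fst x" "snd x + fst x *\<^sub>R ?e"] by (simp add: C_def)
    then show "fst x = fst (\<Sum>j\<in>UNIV. C j x *\<^sub>R (1, rvec (\<alpha>0 \<alpha> (Some j))))"
      by (simp add: fst_sum)
    have "snd x + fst x *\<^sub>R ?e = (\<Sum>j\<in>UNIV. C j x *\<^sub>R rvec (\<alpha> (Some j)))"
      unfolding C_def by (rule calL_expansion(1))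
    then show "snd x = snd (\<Sum>j\<in>UNIV. C j x *\<^sub>R (1, rvec (\<alpha>0 \<alpha> (Some j))))"
      using fst by (simp add: snd_sum edge scaleR_diff_right sum_subtractf flip: scaleR_left.sum)
        (metis add_diff_cancel_right')
  qed
  have vertex_in_cone: "(1, rvec (\<alpha>0 \<alpha> (Some j))) \<in> cone_facet \<alpha> (Some r)" if "j \<noteq> r" for j
  proof -
    have "rvec (\<alpha>0 \<alpha> (Some j)) \<in> facet \<alpha> (Some r)"
      unfolding facet_def using that by (intro hull_inc) auto
    then show ?thesis
      unfolding cone_facet_def by (intro UN_I) (auto intro: exI[of _ 1])
  qed
  have "L_facet \<alpha> (Some r) = \<Lambda>"
    unfolding L_facet_def
  proof (rule the_equality)
    have lin: "linear \<Lambda>"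
      unfolding \<Lambda>_def using linC[of r] by (simp add: linear_iff add_divide_distrib)
    have aff: "facet \<alpha> (Some r) \<subseteq> {v. C r (1, v) = 0}"
      unfolding facet_def
    proof (rule hull_minimal)
      have "C r (1, rvec (\<alpha>0 \<alpha> j)) = 0" if "j \<noteq> None" "j \<noteq> Some r" for j
        using that C_vertex[of r] by (cases j) auto
      then show "{rvec (\<alpha>0 \<alpha> j) |j. j \<noteq> None \<and> j \<noteq> Some r} \<subseteq> {v. C r (1, v) = 0}"
        by blast
      obtain w c where "\<And>a k. calL \<alpha> (Some r) a 0 k = w \<bullet> a + c * k"
        using calL_affine by blast
      then have "{v. C r (1, v) = 0} = {v. w \<bullet> v = - (w \<bullet> ?e) - c}"
        by (auto simp: C_def algebra_simps)
      then show "convex {v. C r (1, v) = 0}"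
        by (simp add: convex_hyperplane)
    qed
    have "\<Lambda> x = 0" if x: "x \<in> cone_facet \<alpha> (Some r)" for x
    proof -
      obtain v c where "v \<in> facet \<alpha> (Some r)" "x = c *\<^sub>R (1, v)"
        using x unfolding cone_facet_def by blast
      then show ?thesis
        using aff linear_scale[OF lin, of c "(1, v)"] by (auto simp: \<Lambda>_def)
    qed
    moreover have "\<Lambda> (t, 0) = - t" for t
    proof -
      have "\<Lambda> (t, 0) = t * \<Lambda> (1, 0)"
        using linear_scale[OF lin, of t "(1, 0)"] by simp
      also have "\<Lambda> (1, 0) = - 1"
        using l by (simp add: \<Lambda>_def C_def l_def)
      finally show ?thesis by simp
    qed
    ultimately show "linear \<Lambda> \<and> (\<forall>x\<in>cone_facet \<alpha> (Some r). \<Lambda> x = 0) \<and>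
        (\<forall>k\<in>{1..CARD('n)}. \<Lambda> (real k, 0) = - real k)"
      using lin by blast
  next
    fix L :: "real \<times> (real ^ 'n) \<Rightarrow> real"
    assume L: "linear L \<and> (\<forall>x\<in>cone_facet \<alpha> (Some r). L x = 0) \<and>
        (\<forall>k\<in>{1..CARD('n)}. L (real k, 0) = - real k)"
    let ?v = "L (1, rvec (\<alpha>0 \<alpha> (Some r)))"
    have L_eq: "L x = C r x * ?v" for x
    proof -
      have "L x = (\<Sum>j\<in>UNIV. C j x * L (1, rvec (\<alpha>0 \<alpha> (Some j))))"
        using L arg_cong[OF span[of x], of L]
        by (simp add: linear_sum linear_scale del: scaleR_Pair)
      also have "\<dots> = (\<Sum>j\<in>{r}. C j x * L (1, rvec (\<alpha>0 \<alpha> (Some j))))"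
        using L vertex_in_cone by (intro sum.mono_neutral_right) auto
      finally show ?thesis by simp
    qed
    \<comment> \<open>The normalisation for \<open>k = 1\<close> is available because every index type is nonempty.\<close>
    have "L (real 1, 0) = - real 1"
      using L by (metis atLeastAtMost_iff le_refl zero_less_card_finite Suc_leI One_nat_def)
    then have "l * ?v = - 1"
      using L_eq[of "(1, 0)"] by (simp add: C_def l_def)
    then have "?v = - 1 / l"
      using l by (simp add: field_simps)
    then have "L x = \<Lambda> x" for x
      using L_eq[of x] by (simp add: \<Lambda>_def)
    then show "L = \<Lambda>"
      by (rule ext)
  qed
  then show ?thesis
    by (simp add: \<Lambda>_def C_def l_def)
qed

end

section \<open>The two linear forms are opposite\<close>

theorem lemma6p2:
  fixes \<alpha> :: "'n::finite option option \<Rightarrow> int ^ 'n"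
    and s :: "'a::comm_ring_1"
  assumes "\<alpha> idx_n1 = 0"
    and "int CARD('n) simplex (convex hull ((\<lambda>j. rvec (\<alpha> j)) ` {j. j \<noteq> idx_n2}))"
    and "rvec (\<alpha> idx_n2) \<in> interior (convex hull ((\<lambda>j. rvec (\<alpha> j)) ` {j. j \<noteq> idx_n2}))"
    and "gamma \<alpha> > 0"
  shows "\<forall>x\<in>(\<Union>l::nat. {real l} \<times> (\<lambda>y. real l *\<^sub>R y) ` newton_polytope (laurent_f \<alpha> s)).
           \<forall>q. q \<noteq> idx_n2 \<longrightarrow> L_facet \<alpha> q (proj \<alpha> x) + L_tilde \<alpha> q x = 0"
proof (intro ballI allI impI)
  fix x :: "real \<times> (real ^ 'n)" and q :: "'n option option"
  assume "q \<noteq> idx_n2"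
  then obtain r where q: "q = Some r"
    by auto
  obtain k a where x: "x = (k, a)"
    by (cases x)
  note pos = calL_interior_point_pos[OF assms(1,4,3)]
  have "L_facet \<alpha> q (proj \<alpha> x) = - calL \<alpha> q a 0 k / calL \<alpha> q (rvec (\<alpha> idx_n2)) 0 1"
    using L_facet_eq[OF assms(1,4) pos] by (simp add: q x proj_def)
  moreover have "L_tilde \<alpha> q x = calL \<alpha> q a 0 k / calL \<alpha> q (rvec (\<alpha> idx_n2)) 0 1"
    using B_vol_eq[OF assms(1,4) pos] assms(4) pos[of r] by (simp add: q x L_tilde_def)
  ultimately show "L_facet \<alpha> q (proj \<alpha> x) + L_tilde \<alpha> q x = 0"
    by simp
qed

end
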